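(* For every integer $m\ge 1$, the following identity of formal power series in $\lambda$ with coefficients in $\mathbb{Q}(q)$ holds: $$\sum_{N=0}^{\infty}\lambda^N\,\big\langle \mathrm{tr}\,X^{2m}\big\rangle_{q} \;=\; [2m-1]!!\;\frac{q^{m}\,\lambda\,\prod_{n=1}^{m}\left(q^{2n}+\lambda\right)}{\left(q^{2m}-\lambda\right)\prod_{n=0}^{m}\left(1-q^{2n}\lambda\right)} .$$ Here the right-hand side is understood as its Taylor expansion at $\lambda=0$, and $\langle \mathrm{tr}\,X^{2m}\rangle_q$ is the one-point (single-trace) correlator of the $q$-deformed Hermitian Gaussian matrix model of size $N$.
   Context: Let $q$ be an indeterminate. The $q$-numbers are $[n]=\frac{q^{-n}-q^{n}}{q^{-1}-q}$, and $[2m-1]!!=[1][3][5]\cdots[2m-1]$. Let $\Lambda$ be the ring of symmetric functions over $\mathbb{Q}(q)$, viewed as the polynomial ring $\mathbb{Q}(q)[p_1,p_2,\dots]$ in the power sums, and let $\chi_R\in\Lambda$ denote the Schur function of the partition $R$. For a sequence $(a_k)_{k\ge1}$ of scalars, $\chi_R(a_k)$ denotes the value of $\chi_R$ under the substitution $p_k\mapsto a_k$ for all $k\geq 1$. Define the following specializations. - For $n=1,2$: $\delta_{k|n}=n\,\frac{(q^{-1}-q)^{k/n}}{q^{-k}-q^{k}}$ if $n$ divides $k$, and $\delta_{k|n}=0$ otherwise. - For an integer $N\ge 0$: $p_k^{*}=\frac{q^{-Nk}-q^{Nk}}{q^{-k}-q^{k}}$. For each integer $N\ge 0$, the average $\langle\,\cdot\,\rangle_q$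 of the $q$-deformed Hermitian Gaussian matrix model of size $N$ is the $\mathbb{Q}(q)$-linear functional on $\Lambda$ determined on the Schur basis by $$\langle \chi_R\rangle_q=\frac{\chi_R(\delta_{k|2})}{\chi_R(\delta_{k|1})}\;\chi_R(p_k^{*})\qquad\text{for every partition } R .$$ The symbol $\mathrm{tr}\,X^{j}$ denotes the power sum $p_j\in\Lambda$ (in terms of eigenvalues, $x_1^j+\dots+x_N^j$). The dependence of $\langle\,\cdot\,\rangle_q$ on $N$ enters only through $p_k^{*}$. *)

theory Defs
  imports
    "HOL-Library.Poly_Mapping"
    "HOL-Computational_Algebra.Fraction_Field"
    "HOL-Computational_Algebra.Formal_Power_Series"
    "Jordan_Normal_Form.Determinant"
begin

section \<open>The field $\mathbf{Q}(q)$ and $q$-numbers\<close>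

type_synonym qfield = "rat poly fract"

definition q :: qfield where
  "q = Fract [:0, 1:] 1"

definition qnum :: "int \<Rightarrow> qfield" where
  "qnum n = (q powi (- n) - q powi n) / (q powi (- 1) - q)"

definition qdfact_odd :: "nat \<Rightarrow> qfield" where
  "qdfact_odd m = (\<Prod>j=1..m. qnum (2 * int j - 1))"

section \<open>Symmetric functions as polynomials in the power sums\<close>

text \<open>
  A monomial is a finitely supported map from variable indices to exponents.  Variables
  are numbered from 0 while power sums are numbered from 1, so the variable with index \<open>i\<close>
  is the power sum $p_{i+1}$; there is no $p_0$, and \<open>psum 0\<close> is a junk value.
\<close>

type_synonym symfun = "(nat \<Rightarrow>\<^sub>0 nat) \<Rightarrow>\<^sub>0 qfield"

definition sym_scale :: "qfield \<Rightarrow> symfun \<Rightarrow> symfun" where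
  "sym_scale c f = Poly_Mapping.single 0 c * f"

lemma vector_space_sym_scale: "vector_space sym_scale"
  by unfold_locales
    (simp_all add: sym_scale_def distrib_left distrib_right single_add mult_single
      flip: mult.assoc)

definition psum :: "nat \<Rightarrow> symfun" where
  "psum k = Poly_Mapping.single (Poly_Mapping.single (k - 1) 1) 1"

text \<open>The value of \<open>f\<close> under the substitution $p_k \mapsto a_k$ for all $k \ge 1$.\<close>

definition specialize :: "(nat \<Rightarrow> qfield) \<Rightarrow> symfun \<Rightarrow> qfield" where
  "specialize a f =
     (\<Sum>mon \<in> Poly_Mapping.keys f. Poly_Mapping.lookup f mon *
        (\<Prod>i \<in> Poly_Mapping.keys mon. a (i + 1) ^ Poly_Mapping.lookup mon i))"

text \<open>
  Complete homogeneous symmetric functions.  Differentiating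
  $\sum_n h_n z^n = \exp (\sum_{k \ge 1} p_k z^k / k)$ gives $h_0 = 1$ and the recursion
  $n h_n = \sum_{k=1}^n p_k h_{n-k}$.
\<close>

fun hsym :: "nat \<Rightarrow> symfun" where
  "hsym 0 = 1"
| "hsym (Suc n) =
     sym_scale (1 / of_nat (Suc n)) (\<Sum>k\<le>n. psum (Suc k) * hsym (n - k))"

definition is_partition :: "nat list \<Rightarrow> bool" where
  "is_partition R \<longleftrightarrow> sorted_wrt (\<ge>) R \<and> 0 \<notin> set R"

text \<open>
  Schur functions by the Jacobi--Trudi determinant of $h_{R_i - i + j}$, where $h_n = 0$ for
  $n < 0$; the guard avoids truncated subtraction.
\<close>

definition schur :: "nat list \<Rightarrow> symfun" where
  "schur R = det (mat (length R) (length R)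
     (\<lambda>(i, j). if i \<le> R ! i + j then hsym (R ! i + j - i) else 0))"

section \<open>The $q$-deformed Gaussian average\<close>

text \<open>\<open>delta_spec n k\<close> is $\delta_{k|n}$.\<close>

definition delta_spec :: "nat \<Rightarrow> nat \<Rightarrow> qfield" where
  "delta_spec n k =
     (if n dvd k
      then of_nat n * (q powi (- 1) - q) ^ (k div n) / (q powi (- int k) - q powi int k)
      else 0)"

definition pstar :: "nat \<Rightarrow> nat \<Rightarrow> qfield" where
  "pstar N k =
     (q powi (- int (N * k)) - q powi int (N * k)) / (q powi (- int k) - q powi int k)"

definition is_q_gaussian_average :: "nat \<Rightarrow> (symfun \<Rightarrow> qfield) \<Rightarrow> bool" where
  "is_q_gaussian_average N L \<longleftrightarrow>
     Vector_Spaces.linear sym_scale (*) L \<and>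
     (\<forall>R. is_partition R \<longrightarrow>
        L (schur R) =
          specialize (delta_spec 2) (schur R) / specialize (delta_spec 1) (schur R)
          * specialize (pstar N) (schur R))"

end

(*
  The power sum p_n is the alternating sum of the hook Schur functions of size n, so only hooks
  contribute.  For a specialization p_k = (u^k - v^k) / (1 - t^k) the hook Schur functions have
  a product formula (hook lengths and contents), because h_n does and Jacobi-Trudi gives
  s(a|b) + s(a+1|b-1) = h_(a+1) e_b.  With t = q^2 this covers delta_{k|1} and p*_k; delta_{k|2}
  is supported on even k, where it is twice such a specialization with t = q^4, and a hook of
  even size then reduces to a hook of half the size.  The quotient of the p*- and delta_{k|1}-values of the hook
  with arm 2m-1-b and leg b is t^m (1-t)^(-2m) t^(-mN) times the product of the
  1 - t^(N+c), -b <= c < 2m-b, hence its generating function is a multiple of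
  M^(b+1) / prod_{j=0}^{2m} (1 - t^j M) with M = t^(-m) lambda.  The remaining sum over b is
  (1 + M) times a q-binomial sum in M^2 with base t^2, equal to prod_{i=1}^{m-1} (1 - t^(2i) M^2).
*)
theory Submission
  imports Defs
begin

section \<open>Specialization as a ring homomorphism\<close>

definition mon_value :: "(nat \<Rightarrow> 'a::comm_monoid_mult) \<Rightarrow> (nat \<Rightarrow>\<^sub>0 nat) \<Rightarrow> 'a" where
  "mon_value a e = (\<Prod>i \<in> Poly_Mapping.keys e. a (i + 1) ^ Poly_Mapping.lookup e i)"

lemma mon_value_superset:
  assumes "finite A" "Poly_Mapping.keys e \<subseteq> A"
  shows "mon_value a e = (\<Prod>i\<in>A. a (i + 1) ^ Poly_Mapping.lookup e i)"
  unfolding mon_value_def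
  by (rule prod.mono_neutral_left) (use assms in \<open>auto simp: in_keys_iff\<close>)

lemma mon_value_zero [simp]: "mon_value a 0 = 1"
  by (simp add: mon_value_def)

lemma mon_value_add: "mon_value a (m1 + m2) = mon_value a m1 * mon_value a m2"
proof -
  let ?A = "Poly_Mapping.keys m1 \<union> Poly_Mapping.keys m2"
  have "Poly_Mapping.keys (m1 + m2) \<subseteq> ?A" by (rule Poly_Mapping.keys_add)
  then show ?thesis
    by (simp add: mon_value_superset[of ?A] lookup_add power_add prod.distrib)
qed

text \<open>Cancellation can remove keys from a sum, so additivity is proved over one index set that
  contains the keys of both summands and of the result.\<close>

lemma specialize_superset:
  assumes "finite A" "Poly_Mapping.keys f \<subseteq> A"
  shows "specialize a f = (\<Sum>e\<in>A. Poly_Mapping.lookup f e * mon_value a e)"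
  unfolding specialize_def mon_value_def
  by (rule sum.mono_neutral_left) (use assms in \<open>auto simp: in_keys_iff\<close>)

lemma specialize_single: "specialize a (Poly_Mapping.single e c) = c * mon_value a e"
  by (subst specialize_superset[of "{e}"]) auto

lemma specialize_add: "specialize a (f + g) = specialize a f + specialize a g"
proof -
  let ?A = "Poly_Mapping.keys f \<union> Poly_Mapping.keys g"
  have "Poly_Mapping.keys (f + g) \<subseteq> ?A" by (rule Poly_Mapping.keys_add)
  then show ?thesis
    by (simp add: specialize_superset[of ?A] lookup_add algebra_simps sum.distrib)
qed

lemma specialize_zero [simp]: "specialize a 0 = 0"
  by (simp add: specialize_def)

lemma specialize_one [simp]: "specialize a 1 = 1"
  using specialize_single[of a 0 1] by simp

lemma specialize_uminus: "specialize a (- f) = - specialize a f"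
  using specialize_add[of a f "- f"] by (simp add: eq_neg_iff_add_eq_0 add.commute)

lemma specialize_diff: "specialize a (f - g) = specialize a f - specialize a g"
  using specialize_add[of a f "- g"] by (simp add: specialize_uminus)

lemma specialize_sum: "specialize a (\<Sum>i\<in>I. f i) = (\<Sum>i\<in>I. specialize a (f i))"
  by (induction I rule: infinite_finite_induct) (simp_all add: specialize_add)

lemma poly_mapping_eq_sum_single:
  "f = (\<Sum>k\<in>Poly_Mapping.keys f. Poly_Mapping.single k (Poly_Mapping.lookup f k))"
  by (rule poly_mapping_eqI) (simp add: lookup_sum lookup_single when_def in_keys_iff)

text \<open>Both factors are expanded into monomials, where \<open>mon_value_add\<close>
  applies.\<close>

lemma specialize_mult: "specialize a (f * g) = specialize a f * specialize a g"
proof -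
  have "specialize a (f * g) =
      specialize a (\<Sum>k\<in>Poly_Mapping.keys f. \<Sum>l\<in>Poly_Mapping.keys g.
        Poly_Mapping.single (k + l) (Poly_Mapping.lookup f k * Poly_Mapping.lookup g l))"
    by (subst (1) poly_mapping_eq_sum_single[of f], subst (1) poly_mapping_eq_sum_single[of g])
      (simp only: sum_product mult_single)
  also have "\<dots> = specialize a f * specialize a g"
    by (simp add: specialize_sum specialize_single mon_value_add sum_product
      specialize_superset[of "Poly_Mapping.keys f" f] specialize_superset[of "Poly_Mapping.keys g" g] mult_ac)
  finally show ?thesis .
qed

lemma specialize_sym_scale: "specialize a (sym_scale c f) = c * specialize a f"
  by (simp add: sym_scale_def specialize_mult specialize_single)

lemma specialize_psum: "k > 0 \<Longrightarrow> specialize a (psum k) = a k"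
  by (simp add: psum_def specialize_single mon_value_def)

section \<open>Powers of q in the field Q(q)\<close>

lemma q_ne_0 [simp]: "q \<noteq> 0"
  unfolding q_def by (simp add: Zero_fract_def eq_fract)

lemma q_power: "q ^ n = Fract (monom 1 n) 1"
proof (induction n)
  case (Suc n)
  have "[:0, 1:] * monom 1 n = (monom 1 (Suc n) :: rat poly)" by (simp add: monom_Suc)
  then show ?case unfolding power_Suc Suc by (subst q_def) (simp only: mult_fract mult_1_left)
qed (simp add: One_fract_def monom_0 flip: one_pCons)

text \<open>\<open>q ^ n\<close> is a monomial of degree \<open>n\<close>, so q is not a root of
  unity; this keeps all denominators $1 - t^k$ with $t = q^2$ or $t = q^4$ nonzero.\<close>

lemma q_power_ne_1: "n > 0 \<Longrightarrow> q ^ n \<noteq> 1"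
  unfolding q_power One_fract_def by (simp add: eq_fract monom_eq_1_iff)

lemma of_nat_qfield_ne_0: "n > 0 \<Longrightarrow> (of_nat n :: qfield) \<noteq> 0"
  unfolding of_nat_fract Zero_fract_def by (simp add: eq_fract)

section \<open>Hook Schur functions\<close>

text \<open>\<open>hook h a b\<close> is the Schur function of the hook with arm \<open>a\<close> and leg \<open>b\<close>, in Frobenius
  notation $(a|b)$, when \<open>h\<close> is the sequence of complete homogeneous functions; the recursion is the
  Laplace expansion of the Jacobi--Trudi determinant along its first column.\<close>

fun hook :: "(nat \<Rightarrow> 'a::comm_ring_1) \<Rightarrow> nat \<Rightarrow> nat \<Rightarrow> 'a" where
  "hook h a 0 = h (Suc a)"
| "hook h a (Suc b) = h (Suc a) * hook h 0 b - hook h (Suc a) b"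

text \<open>The Jacobi-Trudi matrix of $(a+1, 1^b)$. Below the two entries $h_{a+1}$ and $h_0$ its
  first column is zero.\<close>

definition hook_mat :: "(nat \<Rightarrow> 'a::comm_ring_1) \<Rightarrow> nat \<Rightarrow> nat \<Rightarrow> 'a mat" where
  "hook_mat h a b = mat (Suc b) (Suc b)
     (\<lambda>(i, j). if i = 0 then h (Suc a + j) else if i \<le> Suc j then h (Suc j - i) else 0)"

text \<open>Deleting row 0 leaves the matrix of a column, deleting row 1 the matrix with the arm
  longer by one; the second cofactor carries the minus sign.\<close>

lemma det_hook_mat:
  assumes "h 0 = 1"
  shows "det (hook_mat h a b) = hook h a b"
proof (induction b arbitrary: a)
  case 0
  then show ?case by (simp add: hook_mat_def det_single)
next
  case (Suc b)
  have c: "hook_mat h a (Suc b) \<in> carrier_mat (Suc (Suc b)) (Suc (Suc b))"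
    by (simp add: hook_mat_def)
  have d0: "mat_delete (hook_mat h a (Suc b)) 0 0 = hook_mat h 0 b"
    by (rule eq_matI) (auto simp: mat_delete_def hook_mat_def)
  have d1: "mat_delete (hook_mat h a (Suc b)) (Suc 0) 0 = hook_mat h (Suc a) b"
    by (rule eq_matI) (auto simp: mat_delete_def hook_mat_def)
  have "det (hook_mat h a (Suc b)) =
      (\<Sum>i<Suc (Suc b). hook_mat h a (Suc b) $$ (i, 0) * cofactor (hook_mat h a (Suc b)) i 0)"
    by (rule laplace_expansion_column[OF c]) simp
  also have "\<dots> = (\<Sum>i\<in>{0, Suc 0}. hook_mat h a (Suc b) $$ (i, 0) * cofactor (hook_mat h a (Suc b)) i 0)"
    by (rule sum.mono_neutral_right) (auto simp: hook_mat_def)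
  also have "\<dots> = hook h a (Suc b)"
    by (simp add: cofactor_def d0 d1 Suc.IH) (simp add: hook_mat_def assms)
  finally show ?case .
qed

lemma schur_hook: "schur (Suc a # replicate b 1) = hook hsym a b"
proof -
  have "schur (Suc a # replicate b 1) = det (hook_mat hsym a b)"
    unfolding schur_def
  proof (rule arg_cong[of _ _ det], rule eq_matI, goal_cases)
    case (1 i j)
    then show ?case
      by (cases i) (auto simp: hook_mat_def)
  qed (auto simp: hook_mat_def)
  then show ?thesis by (simp add: det_hook_mat)
qed

lemma is_partition_hook: "is_partition (Suc a # replicate b 1)"
  by (induction b) (auto simp: is_partition_def)

text \<open>$e_n$ is the Schur function of a column, the hook with arm 0 and leg $n-1$; $e_0$ is
  separate because no hook is empty.\<close>

definition elem_sym :: "(nat \<Rightarrow> 'a::comm_ring_1) \<Rightarrow> nat \<Rightarrow> 'a" where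
  "elem_sym h n = (case n of 0 \<Rightarrow> 1 | Suc b \<Rightarrow> hook h 0 b)"

text \<open>Unrolls $s(a|b) = h_{a+1} e_b - s(a+1|b-1)$ until the leg is used up.\<close>

lemma hook_eq_sum:
  "hook h a b = (\<Sum>i\<le>b. (- 1) ^ i * h (Suc a + i) * elem_sym h (b - i))"
proof (induction b arbitrary: a)
  case (Suc b)
  show ?case
    by (subst sum.atMost_Suc_shift) (simp add: Suc.IH elem_sym_def sum_negf)
qed (simp add: elem_sym_def)

text \<open>This is $H(z) E(-z) = 1$. The case $a = 0$ of \<open>hook_eq_sum\<close> says that the
  coefficient of $z^{b+1}$ vanishes.\<close>

lemma elem_sym_fps_inverse:
  assumes "h 0 = 1"
  shows "Abs_fps h * Abs_fps (\<lambda>n. (- 1) ^ n * elem_sym h n) = 1"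
proof (rule fps_ext)
  fix n
  show "fps_nth (Abs_fps h * Abs_fps (\<lambda>n. (- 1) ^ n * elem_sym h n)) n = fps_nth 1 n"
  proof (cases n)
    case (Suc b)
    have "(\<Sum>i\<le>b. (- 1) ^ i * h (Suc i) * elem_sym h (b - i)) = elem_sym h (Suc b)"
      using hook_eq_sum[of h 0 b] by (simp add: elem_sym_def)
    moreover have "(\<Sum>i\<le>b. h (Suc i) * ((- 1) ^ (b - i) * elem_sym h (b - i))) =
        (- 1) ^ b * (\<Sum>i\<le>b. (- 1) ^ i * h (Suc i) * elem_sym h (b - i))"
      unfolding sum_distrib_left by (rule sum.cong) (auto simp: minus_one_power_iff)
    ultimately have "(\<Sum>i\<le>b. h (Suc i) * ((- 1) ^ (b - i) * elem_sym h (b - i))) =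
        (- 1) ^ b * elem_sym h (Suc b)"
      by simp
    then show ?thesis
      by (simp add: fps_mult_nth Suc atLeast0AtMost assms elem_sym_def del: sum.atMost_Suc hook.simps)
         (subst sum.atMost_Suc_shift, simp add: assms)
  qed (simp add: assms elem_sym_def)
qed

text \<open>With $H(z) E(-z) = 1$, Newton's identity $z H' = P H$ becomes $P = z H' E(-z)$.\<close>

lemma newton_hook:
  assumes "h 0 = 1"
    and newton: "\<And>n. of_nat n * h n = (\<Sum>i\<le>n. P i * h (n - i))"
  shows "P n = (\<Sum>b<n. (- 1) ^ b * hook h (n - 1 - b) b)"
proof -
  define H where "H = Abs_fps h"
  define E where "E = Abs_fps (\<lambda>n. (- 1) ^ n * elem_sym h n)"
  have HE: "H * E = 1" unfolding H_def E_def by (rule elem_sym_fps_inverse, fact)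
  have "Abs_fps (\<lambda>n. of_nat n * h n) = Abs_fps P * H"
    by (rule fps_ext) (simp add: fps_mult_nth H_def newton atLeast0AtMost)
  then have "Abs_fps P = Abs_fps (\<lambda>n. of_nat n * h n) * E"
    by (simp add: mult.assoc HE)
  then have "P n = fps_nth (Abs_fps (\<lambda>n. of_nat n * h n) * E) n"
    by (metis fps_nth_Abs_fps)
  also have "\<dots> = (\<Sum>k\<le>n. of_nat (n - k) * h (n - k) * ((- 1) ^ k * elem_sym h k))"
    unfolding fps_mult_nth E_def atLeast0AtMost fps_nth_Abs_fps
    by (rule sum.reindex_bij_witness[of _ "\<lambda>i. n - i" "\<lambda>i. n - i"]) auto
  also have "\<dots> = (\<Sum>k<n. of_nat (n - k) * h (n - k) * ((- 1) ^ k * elem_sym h k))"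
    by (rule sum.mono_neutral_right) auto
  \<comment> \<open>The factor $n-k$ counts the $b$ with $k \<le> b < n$. After the interchange, the
    inner sum over $k$ is the expansion of the hook $(n-1-b|b)$.\<close>
  also have "\<dots> = (\<Sum>k<n. \<Sum>b=k..<n. (- 1) ^ k * (h (n - k) * elem_sym h k))"
    by (rule sum.cong) (auto simp: mult_ac)
  also have "\<dots> = (\<Sum>b<n. \<Sum>k\<le>b. (- 1) ^ k * (h (n - k) * elem_sym h k))"
    by (subst (1 2) sum.Sigma)
       (auto intro!: sum.reindex_bij_witness[of _ prod.swap prod.swap])
  also have "\<dots> = (\<Sum>b<n. (- 1) ^ b * hook h (n - 1 - b) b)"
  proof (rule sum.cong[OF refl])
    fix b assume "b \<in> {..<n}"
    then have b: "b < n" by simp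
    have "(\<Sum>k\<le>b. (- 1) ^ k * (h (n - k) * elem_sym h k)) =
        (\<Sum>i\<le>b. (- 1) ^ (b - i) * (h (n - (b - i)) * elem_sym h (b - i)))"
      by (rule sum.reindex_bij_witness[of _ "\<lambda>i. b - i" "\<lambda>i. b - i"]) auto
    also have "\<dots> = (- 1) ^ b * hook h (n - 1 - b) b"
      unfolding hook_eq_sum sum_distrib_left
    proof (rule sum.cong[OF refl])
      fix i assume "i \<in> {..b}"
      then have "n - (b - i) = Suc (n - 1 - b) + i" "i \<le> b" using b by auto
      then show "(- 1) ^ (b - i) * (h (n - (b - i)) * elem_sym h (b - i)) =
          (- 1) ^ b * ((- 1) ^ i * h (Suc (n - 1 - b) + i) * elem_sym h (b - i))"
        by (auto simp: minus_one_power_iff)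
    qed
    finally show "(\<Sum>k\<le>b. (- 1) ^ k * (h (n - k) * elem_sym h k)) = (- 1) ^ b * hook h (n - 1 - b) b" .
  qed
  finally show ?thesis .
qed

text \<open>The recursion defining \<open>hsym\<close>, cleared of its denominator; the guard at 0
  shuts out the junk value \<open>psum 0\<close>.\<close>

lemma newton_hsym: "of_nat n * hsym n = (\<Sum>i\<le>n. (if i = 0 then 0 else psum i) * hsym (n - i))"
proof (cases n)
  case (Suc k)
  have e: "(of_nat m :: symfun) = Poly_Mapping.single 0 (of_nat m)" for m
    by simp
  have "of_nat n * hsym n =
      sym_scale (of_nat (Suc k)) (sym_scale (1 / of_nat (Suc k)) (\<Sum>i\<le>k. psum (Suc i) * hsym (k - i)))"
    unfolding Suc hsym.simps sym_scale_def e ..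
  also have "\<dots> = (\<Sum>i\<le>k. psum (Suc i) * hsym (k - i))"
  proof -
    have "Poly_Mapping.single 0 (of_nat (Suc k)) * Poly_Mapping.single 0 (1 / of_nat (Suc k)) = (1 :: symfun)"
      using of_nat_qfield_ne_0[of "Suc k"] by (subst mult_single) (simp del: of_nat_Suc)
    then show ?thesis
      unfolding sym_scale_def mult.assoc[symmetric] by simp
  qed
  finally show ?thesis
    by (simp add: Suc sum.atMost_Suc_shift del: hsym.simps sum.atMost_Suc)
qed simp

lemma psum_hook:
  assumes "n > 0"
  shows "psum n = (\<Sum>b<n. (- 1) ^ b * hook hsym (n - 1 - b) b)"
proof -
  have "(if n = 0 then 0 else psum n) = (\<Sum>b<n. (- 1) ^ b * hook hsym (n - 1 - b) b)"
    by (rule newton_hook[of hsym "\<lambda>i. if i = 0 then 0 else psum i"]) (simp_all add: newton_hsym)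
  with assms show ?thesis by simp
qed

lemma specialize_hook: "specialize a (hook h i j) = hook (\<lambda>n. specialize a (h n)) i j"
  by (induction j arbitrary: i) (simp_all add: specialize_diff specialize_mult)

text \<open>Positive integers are invertible in the field, so Newton's identities with $h_0 = 1$
  have only one solution: a guessed sequence need only be checked against them.\<close>

lemma specialize_hsym_eqI:
  assumes "h 0 = 1"
    and newton: "\<And>n. of_nat n * h n = (\<Sum>i\<le>n. (if i = 0 then 0 else a i) * h (n - i))"
  shows "specialize a (hsym n) = h n"
proof (induction n rule: less_induct)
  case (less n)
  show ?case
  proof (cases n)
    case (Suc k)
    have "specialize a (hsym n) = 1 / of_nat (Suc k) * (\<Sum>i\<le>k. a (Suc i) * h (k - i))"
      using less by (simp add: Suc specialize_sym_scale specialize_sum specialize_mult specialize_psum)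
    also have "(\<Sum>i\<le>k. a (Suc i) * h (k - i)) = of_nat (Suc k) * h (Suc k)"
      unfolding newton by (subst sum.atMost_Suc_shift) simp
    finally show ?thesis
      using of_nat_qfield_ne_0[of "Suc k"] by (simp add: Suc del: of_nat_Suc)
  qed (simp add: assms)
qed

section \<open>Specializations given by a product formula\<close>

text \<open>The q-shifted factorial $(t;t)_n$.\<close>

definition qpoch :: "'a::field \<Rightarrow> nat \<Rightarrow> 'a" where
  "qpoch t n = (\<Prod>i=1..n. 1 - t ^ i)"

lemma qpoch_0 [simp]: "qpoch t 0 = 1" 
  and qpoch_Suc: "qpoch t (Suc n) = (1 - t ^ Suc n) * qpoch t n"
  by (simp_all add: qpoch_def mult.commute)

text \<open>Coefficients of $\prod_{i \ge 0} (1 - v t^i z) / (1 - u t^i z)$, the complete homogeneous series for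
  $p_k = (u^k - v^k) / (1 - t^k)$.\<close>

definition princ_h :: "'a::field \<Rightarrow> 'a \<Rightarrow> 'a \<Rightarrow> nat \<Rightarrow> 'a" where
  "princ_h t u v n = (\<Prod>i<n. u - v * t ^ i) / qpoch t n"

lemma princ_h_0 [simp]: "princ_h t u v 0 = 1"
  by (simp add: princ_h_def)

definition princ_p :: "'a::field \<Rightarrow> 'a \<Rightarrow> 'a \<Rightarrow> nat \<Rightarrow> 'a" where
  "princ_p t u v n = (u ^ n - v ^ n) / (1 - t ^ n)"

text \<open>Hook-content formula: arm cells of content $i$ give $u - v t^i$, leg cells of content
  $-i$ give $t^i (u - v t^{-i})$. The denominator runs over the hook lengths $a+b+1$, $1..a$ and
  $1..b$.\<close>

definition princ_hook :: "'a::field \<Rightarrow> 'a \<Rightarrow> 'a \<Rightarrow> nat \<Rightarrow> nat \<Rightarrow> 'a" where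
  "princ_hook t u v a b =
     (\<Prod>i\<le>a. u - v * t ^ i) * (\<Prod>i=1..b. u * t ^ i - v) /
     ((1 - t ^ Suc (a + b)) * qpoch t a * qpoch t b)"

context
  fixes t :: "'a::field"
  assumes t: "\<And>n. n > 0 \<Longrightarrow> t ^ n \<noteq> 1"
begin

lemma one_minus_power_ne_0: "n > 0 \<Longrightarrow> 1 - t ^ n \<noteq> 0"
  using t[of n] by auto

lemma qpoch_ne_0: "qpoch t n \<noteq> 0"
  using one_minus_power_ne_0 by (auto simp: qpoch_def)

lemma princ_h_Suc: "(1 - t ^ Suc n) * princ_h t u v (Suc n) = (u - v * t ^ n) * princ_h t u v n"
  using one_minus_power_ne_0[of "Suc n"] qpoch_ne_0[of n]
  by (simp add: princ_h_def qpoch_Suc divide_simps mult_ac del: power_Suc)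

text \<open>
  With $W = zH' - AH$, the functional equation $(1 - uz) H(z) = (1 - vz) H(tz)$ gives
  $(1 - uz) W(z) = (1 - vz) W(tz)$, so $W = 0$.
\<close>

lemma newton_princ:
  "of_nat n * princ_h t u v n =
     (\<Sum>i\<le>n. (if i = 0 then 0 else princ_p t u v i) * princ_h t u v (n - i))"
proof -
  \<comment> \<open>\<open>S\<close> substitutes $tz$ for $z$; \<open>D\<close> below is
    $zH'$.\<close>
  define S where "S f = fps_compose f (fps_const t * fps_X)" for f :: "'a fps"
  define H where "H = Abs_fps (princ_h t u v)"
  define D where "D = Abs_fps (\<lambda>n. of_nat n * princ_h t u v n)"
  define A where "A = Abs_fps (\<lambda>i. if i = 0 then 0 else princ_p t u v i)"
  define U where "U = 1 - fps_const u * fps_X"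
  define V where "V = 1 - fps_const v * fps_X"
  define W where "W = D - A * H"
  note defs = H_def D_def A_def U_def V_def
  have S_nth: "fps_nth (S f) n = t ^ n * fps_nth f n" for f n
    unfolding S_def by simp
  have S_mult: "S (f * g) = S f * S g" for f g
    unfolding S_def by (rule fps_compose_mult_distrib) simp
  have S_diff: "S (f - g) = S f - S g" for f g
    unfolding S_def by (rule fps_compose_sub_distrib)
  have UH: "U * H = V * S H"
  proof (rule fps_ext)
    fix n show "fps_nth (U * H) n = fps_nth (V * S H) n"
    proof (cases n)
      case (Suc k)
      then show ?thesis using princ_h_Suc[of k u v]
        by (simp add: U_def V_def algebra_simps S_nth) (simp add: H_def algebra_simps)
    qed (simp add: U_def V_def algebra_simps S_nth)
  qed
  \<comment> \<open>This is $z d/dz$ applied to \<open>UH\<close>; that operator commutes with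
    \<open>S\<close>.\<close>
  have UD: "U * D - fps_const u * fps_X * H = V * S D - fps_const v * fps_X * S H"
  proof (rule fps_ext)
    fix n show "fps_nth (U * D - fps_const u * fps_X * H) n = fps_nth (V * S D - fps_const v * fps_X * S H) n"
    proof (cases n)
      case (Suc k)
      have "of_nat (Suc k) * ((1 - t ^ Suc k) * princ_h t u v (Suc k)) = of_nat (Suc k) * ((u - v * t ^ k) * princ_h t u v k)"
        by (simp only: princ_h_Suc)
      with Suc show ?thesis 
        by (simp add: U_def V_def algebra_simps S_nth) (simp add: H_def D_def algebra_simps)
    qed (simp add: U_def V_def algebra_simps S_nth D_def)
  qed
  \<comment> \<open>In \<open>A - S A\<close> the denominators $1 - t^n$ cancel, leaving the
    geometric series $uz/(1-uz) - vz/(1-vz)$.\<close>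
  have UA: "U * V * (A - S A) = V * (fps_const u * fps_X) - U * (fps_const v * fps_X)"
  proof -
    have g: "(1 - fps_const x * fps_X) * Abs_fps (\<lambda>n. if n = 0 then 0 else x ^ n) = fps_const x * fps_X" for x :: 'a
    proof (rule fps_ext)
      fix n show "fps_nth ((1 - fps_const x * fps_X) * Abs_fps (\<lambda>n. if n = 0 then 0 else x ^ n)) n
        = fps_nth (fps_const x * fps_X) n"
        by (cases n) (auto simp: algebra_simps)
    qed
    have "A - S A = Abs_fps (\<lambda>n. if n = 0 then 0 else u ^ n) - Abs_fps (\<lambda>n. if n = 0 then 0 else v ^ n)"
    proof (rule fps_ext)
      fix n show "fps_nth (A - S A) n =
          fps_nth (Abs_fps (\<lambda>n. if n = 0 then 0 else u ^ n) - Abs_fps (\<lambda>n. if n = 0 then 0 else v ^ n)) n"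
        using one_minus_power_ne_0[of n]
        by (simp add: S_nth A_def princ_p_def divide_simps) (simp add: algebra_simps)
    qed
    note dA = this
    have "U * V * (A - S A) = V * (U * Abs_fps (\<lambda>n. if n = 0 then 0 else u ^ n)) - U * (V * Abs_fps (\<lambda>n. if n = 0 then 0 else v ^ n))"
      unfolding dA by (simp add: algebra_simps)
    then show ?thesis unfolding U_def V_def g .
  qed
  have V0: "V \<noteq> 0"
  proof
    assume "V = 0"
    then have "fps_nth V 0 = 0" by simp
    then show False by (simp add: V_def)
  qed
  \<comment> \<open>The extra factor \<open>V\<close> supplies the product \<open>U * V\<close> in
    \<open>UA\<close> and is cancelled afterwards.\<close>
  have "V * (U * W) = V * (V * S W)"
  proof -
    have "V * S W = V * S D - S A * (V * S H)"
      by (simp add: W_def S_diff S_mult algebra_simps)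
    then have 1: "V * S W = V * S D - S A * (U * H)"
      unfolding UH .
    have 2: "U * W = V * S D - fps_const v * fps_X * S H + fps_const u * fps_X * H - A * (U * H)"
      using UD by (simp add: W_def algebra_simps)
    have "V * (U * W) - V * (V * S W) =
        V * (fps_const u * fps_X) * H - fps_const v * fps_X * (V * S H) - U * V * (A - S A) * H"
      unfolding 1 2 by (simp add: algebra_simps)
    also have "\<dots> = 0"
      unfolding UA UH[symmetric] by (simp add: algebra_simps)
    finally show ?thesis by simp
  qed
  then have UW: "U * W = V * S W" using V0 by simp
  have W: "fps_nth W n = 0" for n
  proof (induction n)
    case 0
    then show ?case by (simp add: W_def D_def A_def)
  next
    case (Suc n)
    have "fps_nth (U * W) (Suc n) = fps_nth (V * S W) (Suc n)" by (simp add: UW)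
    then have "fps_nth W (Suc n) = t ^ Suc n * fps_nth W (Suc n)"
      using Suc by (simp add: U_def V_def algebra_simps S_nth)
    then have "(1 - t ^ Suc n) * fps_nth W (Suc n) = 0"
      by (simp add: algebra_simps)
    with one_minus_power_ne_0[of "Suc n"] show ?case by simp
  qed
  then show ?thesis
    using W[of n] by (simp add: W_def D_def A_def H_def fps_mult_nth atLeast0AtMost)
qed

text \<open>By the recursion in the leg. With $X = t^{a+1}$ and $Y = t^{b+1}$ the step reduces to
  $(uY-v)(1-X) = (u-v)(1-XY) - (u-vX)(1-Y)$.\<close>

lemma princ_hook_eq: "hook (princ_h t u v) a b = princ_hook t u v a b"
proof (induction b arbitrary: a)
  case 0
  show ?case
    by (simp add: princ_hook_def princ_h_def qpoch_Suc lessThan_Suc_atMost)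
next
  case (Suc b)
  define P where "P = (\<Prod>i\<le>a. u - v * t ^ i)"
  define Q where "Q = (\<Prod>i=1..b. u * t ^ i - v)"
  define Qa where "Qa = qpoch t a"
  define Qb where "Qb = qpoch t b"
  define X where "X = t ^ Suc a"
  define Y where "Y = t ^ Suc b"
  have XY: "t ^ Suc (a + Suc b) = X * Y" "t ^ Suc (Suc a + b) = X * Y"
    by (simp_all add: X_def Y_def power_add)
  have nz: "Qa \<noteq> 0" "Qb \<noteq> 0" "1 - X \<noteq> 0" "1 - Y \<noteq> 0" "1 - X * Y \<noteq> 0"
    by (simp_all add: Qa_def Qb_def X_def Y_def qpoch_ne_0 t del: power_Suc flip: power_add)
  have h: "princ_h t u v (Suc a) = P / ((1 - X) * Qa)"
    by (simp add: princ_h_def P_def X_def Qa_def qpoch_Suc lessThan_Suc_atMost)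
  have e: "princ_hook t u v 0 b = (u - v) * Q / ((1 - Y) * Qb)"
    by (simp add: princ_hook_def Q_def Y_def Qb_def)
  have s1: "princ_hook t u v (Suc a) b = P * (u - v * X) * Q / ((1 - X * Y) * ((1 - X) * Qa) * Qb)"
    unfolding princ_hook_def XY
    by (simp add: P_def Q_def Qa_def Qb_def X_def qpoch_Suc)
  have s2: "princ_hook t u v a (Suc b) = P * (Q * (u * Y - v)) / ((1 - X * Y) * Qa * ((1 - Y) * Qb))"
    unfolding princ_hook_def XY
    by (simp add: P_def Q_def Qa_def Qb_def Y_def qpoch_Suc)
  have "P * (Q * (u * Y - v)) / ((1 - X * Y) * Qa * ((1 - Y) * Qb)) =
     P / ((1 - X) * Qa) * ((u - v) * Q / ((1 - Y) * Qb)) -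
     P * (u - v * X) * Q / ((1 - X * Y) * ((1 - X) * Qa) * Qb)"
    using nz by (simp add: divide_simps) (simp add: algebra_simps)
  then show ?case by (simp add: Suc.IH h e s1 s2)
qed

end

section \<open>The three specializations of the model\<close>

text \<open>The complete homogeneous sequence of $H(z^2)$, where \<open>h\<close> is that of $H(z)$.\<close>

definition double_seq :: "(nat \<Rightarrow> 'a::zero) \<Rightarrow> nat \<Rightarrow> 'a" where
  "double_seq h n = (if even n then h (n div 2) else 0)"

lemma double_seq_simps [simp]:
  "double_seq h 0 = h 0" "double_seq h (2 * n) = h n" "double_seq h (Suc (2 * n)) = 0"
  "double_seq h (Suc 0) = 0"
  "double_seq h (Suc (Suc (2 * n))) = h (Suc n)"
  by (simp_all add: double_seq_def)

lemma hook_double_seq: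
  fixes h :: "nat \<Rightarrow> 'a::comm_ring_1"
  shows "hook (double_seq h) (Suc (2 * a)) (2 * b) = (- 1) ^ b * hook h a b"
    and "hook (double_seq h) (2 * a) (Suc (2 * b)) = - ((- 1) ^ b * hook h a b)"
proof -
  have Suc2: "Suc (Suc (2 * x)) = 2 * Suc x" for x by simp
  \<comment> \<open>The recursion mixes the parities of arm and leg, so all four cases are proved
    together; hooks of odd size vanish.\<close>
  have "(\<forall>a. hook (double_seq h) (2 * a) (2 * b) = 0) \<and>
     (\<forall>a. hook (double_seq h) (Suc (2 * a)) (Suc (2 * b)) = 0) \<and>
     (\<forall>a. hook (double_seq h) (Suc (2 * a)) (2 * b) = (- 1) ^ b * hook h a b) \<and>
     (\<forall>a. hook (double_seq h) (2 * a) (Suc (2 * b)) = - ((- 1) ^ b * hook h a b))"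
  proof (induction b)
    case 0
    have "hook (double_seq h) (Suc (Suc (2 * a))) 0 = 0" for a
      by (simp only: Suc2 hook.simps double_seq_simps)
    then show ?case by auto
  next
    case (Suc b)
    have ee: "hook (double_seq h) (2 * a) (Suc (Suc (2 * b))) = 0" for a
      using Suc by (simp only: hook.simps(2)[of _ _ "Suc (2 * b)"]) simp
    have oe: "hook (double_seq h) (Suc (2 * a)) (Suc (Suc (2 * b))) = (- 1) ^ Suc b * hook h a (Suc b)" for a
    proof -
      have IH: "hook (double_seq h) (2 * x) (Suc (2 * b)) = - ((- 1) ^ b * hook h x b)" for x
        using Suc by blast
      show ?thesis
        by (simp only: hook.simps(2)[of _ _ "Suc (2 * b)"] IH[of 0, unfolded mult_0_right]
            IH[of "Suc a", folded Suc2] double_seq_simps hook.simps(2)[of h])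
          (simp add: algebra_simps)
    qed
    have eo: "hook (double_seq h) (2 * a) (Suc (Suc (Suc (2 * b)))) = - ((- 1) ^ Suc b * hook h a (Suc b))" for a
      by (simp only: hook.simps(2)[of _ _ "Suc (Suc (2 * b))"] oe double_seq_simps) simp
    have "hook (double_seq h) (2 * 0) (Suc (Suc (2 * b))) = 0"
      "hook (double_seq h) (2 * Suc a) (Suc (Suc (2 * b))) = 0" for a
      by (rule ee)+
    then have oo: "hook (double_seq h) (Suc (2 * a)) (Suc (Suc (Suc (2 * b)))) = 0" for a
      by (simp only: hook.simps(2)[of _ _ "Suc (Suc (2 * b))"] Suc2 mult_0_right) simp
    show ?case unfolding Suc2[symmetric] using ee oe eo oo by blast
  qed
  then show "hook (double_seq h) (Suc (2 * a)) (2 * b) = (- 1) ^ b * hook h a b"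
    "hook (double_seq h) (2 * a) (Suc (2 * b)) = - ((- 1) ^ b * hook h a b)" by blast+
qed

text \<open>$log H(z^2) = sum_k 2 p_k z^{2k} / (2k)$, so the new power sum in degree $2k$ is $2
  p_k$.\<close>

lemma newton_double_seq:
  fixes h p :: "nat \<Rightarrow> 'a::comm_ring_1"
  assumes "\<And>n. of_nat n * h n = (\<Sum>i\<le>n. p i * h (n - i))"
  shows "of_nat n * double_seq h n = (\<Sum>i\<le>n. double_seq (\<lambda>i. 2 * p i) i * double_seq h (n - i))"
proof (cases "even n")
  case True
  then obtain l where n: "n = 2 * l" by blast
  have "(\<Sum>i\<le>n. double_seq (\<lambda>i. 2 * p i) i * double_seq h (n - i)) =
      (\<Sum>i\<in>(\<lambda>j. 2 * j) ` {..l}. double_seq (\<lambda>i. 2 * p i) i * double_seq h (n - i))"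
    by (rule sum.mono_neutral_right) (auto simp: n double_seq_def elim!: evenE)
  also have "\<dots> = (\<Sum>j\<le>l. 2 * p j * h (l - j))"
    by (subst sum.reindex) (auto simp: n inj_on_def simp flip: diff_mult_distrib2)
  also have "\<dots> = 2 * (of_nat l * h l)"
    by (simp add: assms sum_distrib_left mult.assoc)
  finally show ?thesis by (simp add: n)
next
  case False
  then have "double_seq (\<lambda>i. 2 * p i) i * double_seq h (n - i) = 0" if "i \<le> n" for i
    using that by (simp add: double_seq_def)
  with False show ?thesis by (simp add: double_seq_def)
qed

section \<open>The model's specializations in principal form\<close>

lemma q2_power_ne_1: "n > 0 \<Longrightarrow> (q\<^sup>2) ^ n \<noteq> 1"
  using q_power_ne_1[of "2 * n"] by (simp add: power_mult)

lemma q4_power_ne_1: "n > 0 \<Longrightarrow> (q ^ 4) ^ n \<noteq> 1"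
  using q_power_ne_1[of "4 * n"] by (simp add: power_mult)

lemma q_minus_power_diff: "q powi (- int k) - q powi int k = (1 - (q\<^sup>2) ^ k) / q ^ k"
proof -
  have "(q\<^sup>2) ^ k = q ^ k * q ^ k" by (simp add: power2_eq_square power_mult_distrib)
  then show ?thesis by (simp add: power_int_minus field_simps)
qed

lemma q_inverse_minus: "q powi (- 1) - q = (1 - q\<^sup>2) / q"
  using q_minus_power_diff[of 1] by simp

text \<open>Clearing $q^{-k}$ from the denominator puts a factor $q^k$ into the numerator, which is
  absorbed into $u = q^{1-N}$ and $v = q^{1+N}$; hence $v = u t^N$.\<close>

lemma pstar_eq: "pstar N k = princ_p (q\<^sup>2) (q / q ^ N) (q * q ^ N) k"
proof -
  have e: "(q\<^sup>2) ^ (N * k) = q ^ (N * k) * q ^ (N * k)"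
    by (simp add: power2_eq_square power_mult_distrib)
  show ?thesis
    unfolding pstar_def princ_p_def q_minus_power_diff e
    by (simp add: power_mult power_divide power_mult_distrib field_simps)
qed

lemma delta_spec_1_eq: "k > 0 \<Longrightarrow> delta_spec 1 k = princ_p (q\<^sup>2) (1 - q\<^sup>2) 0 k"
  unfolding delta_spec_def q_minus_power_diff q_inverse_minus princ_p_def
  by (simp add: power_divide field_simps)

lemma delta_spec_2_eq:
  "delta_spec 2 k = double_seq (\<lambda>i. 2 * (if i = 0 then 0 else princ_p (q ^ 4) (q * (1 - q\<^sup>2)) 0 i)) k"
proof (cases "even k")
  case True
  then obtain l where k: "k = 2 * l" by blast
  have e: "(q\<^sup>2) ^ k = (q ^ 4) ^ l" "q ^ k = q ^ l * q ^ l"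
    by (simp_all add: k flip: power_mult power_add mult_2)
  have "delta_spec 2 k = 2 * (((1 - q\<^sup>2) / q) ^ l / ((1 - (q ^ 4) ^ l) / (q ^ l * q ^ l)))"
    unfolding delta_spec_def q_minus_power_diff q_inverse_minus e by (simp add: k)
  \<comment> \<open>For $l = 0$ the left side is 0 because division by zero gives 0.\<close>
  also have "\<dots> = double_seq (\<lambda>i. 2 * (if i = 0 then 0 else princ_p (q ^ 4) (q * (1 - q\<^sup>2)) 0 i)) k"
    unfolding k double_seq_simps by (cases "l = 0") (simp_all add: princ_p_def power_divide power_mult_distrib divide_simps)
  finally show ?thesis .
qed (simp add: delta_spec_def double_seq_def)

lemma specialize_pstar_hook:
  "specialize (pstar N) (hook hsym a b) = princ_hook (q\<^sup>2) (q / q ^ N) (q * q ^ N) a b"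
proof -
  have "specialize (pstar N) (hsym n) = princ_h (q\<^sup>2) (q / q ^ N) (q * q ^ N) n" for n
    by (rule specialize_hsym_eqI)
      (simp_all add: newton_princ q2_power_ne_1 pstar_eq cong: if_cong)
  then show ?thesis
    by (simp add: specialize_hook princ_hook_eq q2_power_ne_1)
qed

lemma specialize_delta_spec_1_hook:
  "specialize (delta_spec 1) (hook hsym a b) = princ_hook (q\<^sup>2) (1 - q\<^sup>2) 0 a b"
proof -
  have "specialize (delta_spec 1) (hsym n) = princ_h (q\<^sup>2) (1 - q\<^sup>2) 0 n" for n
  proof (rule specialize_hsym_eqI)
    show "of_nat n * princ_h (q\<^sup>2) (1 - q\<^sup>2) 0 n =
        (\<Sum>i\<le>n. (if i = 0 then 0 else delta_spec 1 i) * princ_h (q\<^sup>2) (1 - q\<^sup>2) 0 (n - i))" for n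
      by (subst newton_princ, erule q2_power_ne_1)
        (rule sum.cong, simp_all add: delta_spec_1_eq del: One_nat_def)
  qed simp
  then show ?thesis
    by (simp add: specialize_hook princ_hook_eq q2_power_ne_1 del: One_nat_def)
qed

lemma specialize_delta_spec_2_hook:
  "specialize (delta_spec 2) (hook hsym (Suc (2 * a)) (2 * b)) =
     (- 1) ^ b * princ_hook (q ^ 4) (q * (1 - q\<^sup>2)) 0 a b" (is ?A)
  "specialize (delta_spec 2) (hook hsym (2 * a) (Suc (2 * b))) =
     - ((- 1) ^ b * princ_hook (q ^ 4) (q * (1 - q\<^sup>2)) 0 a b)" (is ?B)
proof -
  have "specialize (delta_spec 2) (hsym n) = double_seq (princ_h (q ^ 4) (q * (1 - q\<^sup>2)) 0) n" for n
  proof (rule specialize_hsym_eqI)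
    have z: "(if i = 0 then 0 else delta_spec 2 i) = delta_spec 2 i" for i
      by (simp add: delta_spec_def)
    show "of_nat n * double_seq (princ_h (q ^ 4) (q * (1 - q\<^sup>2)) 0) n =
        (\<Sum>i\<le>n. (if i = 0 then 0 else delta_spec 2 i) *
          double_seq (princ_h (q ^ 4) (q * (1 - q\<^sup>2)) 0) (n - i))" for n
      unfolding z unfolding delta_spec_2_eq
      by (rule newton_double_seq, rule newton_princ, erule q4_power_ne_1)
  qed simp
  moreover have "hook (princ_h (q ^ 4) (q * (1 - q\<^sup>2)) 0) a b = princ_hook (q ^ 4) (q * (1 - q\<^sup>2)) 0 a b"
    by (rule princ_hook_eq) (erule q4_power_ne_1)
  ultimately show ?A ?B
    by (simp_all only: specialize_hook hook_double_seq)
qed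

section \<open>Generating functions\<close>

text \<open>A q-binomial series in $z = sX$: multiplying by the last factor $1 - t^{k+1} z$ lowers
  \<open>k\<close> by one at the cost of the constant $1 - t^{k+1}$.\<close>

lemma gf_shifted_product:
  fixes s t :: "'a::field"
  shows "(\<Prod>j=0..k. 1 - fps_const (t ^ j) * (fps_const s * fps_X)) *
      Abs_fps (\<lambda>n. s ^ n * (\<Prod>i=1..k. 1 - t ^ (n + i))) = fps_const (qpoch t k)"
proof (induction k)
  case 0
  show ?case
  proof (rule fps_ext)
    fix n show "fps_nth ((\<Prod>j=0..0. 1 - fps_const (t ^ j) * (fps_const s * fps_X)) *
      Abs_fps (\<lambda>n. s ^ n * (\<Prod>i=1..0. 1 - t ^ (n + i)))) n = fps_nth (fps_const (qpoch t 0)) n"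
      by (cases n) (simp_all add: algebra_simps)
  qed
next
  case (Suc k)
  define Z where "Z k = Abs_fps (\<lambda>n. s ^ n * (\<Prod>i=1..k. 1 - t ^ (n + i)))" for k
  have "(1 - fps_const (t ^ Suc k) * (fps_const s * fps_X)) * Z (Suc k) = fps_const (1 - t ^ Suc k) * Z k"
  proof (rule fps_ext)
    fix n
    show "fps_nth ((1 - fps_const (t ^ Suc k) * (fps_const s * fps_X)) * Z (Suc k)) n =
        fps_nth (fps_const (1 - t ^ Suc k) * Z k) n"
    proof (cases n)
      case 0
      then show ?thesis by (simp add: Z_def algebra_simps)
    next
      case (Suc l)
      define P where "P = (\<Prod>i=1..k. 1 - t ^ (n + i))"
      have 1: "(\<Prod>i=1..Suc k. 1 - t ^ (n + i)) = (1 - t ^ (n + Suc k)) * P"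
        by (simp add: P_def)
      \<comment> \<open>Adjacent coefficients share the product \<open>P\<close>; what remains is
        $(1 - t^{n+k+1}) - t^{k+1} (1 - t^n) = 1 - t^{k+1}$.\<close>
      have "(\<Prod>i=1..Suc k. 1 - t ^ (l + i)) = (1 - t ^ (l + 1)) * (\<Prod>i=Suc 1..Suc k. 1 - t ^ (l + i))"
        by (rule prod.atLeast_Suc_atMost) simp
      also have "(\<Prod>i=Suc 1..Suc k. 1 - t ^ (l + i)) = P"
        unfolding prod.shift_bounds_cl_Suc_ivl by (simp add: P_def Suc)
      finally have 2: "(\<Prod>i=1..Suc k. 1 - t ^ (l + i)) = (1 - t ^ n) * P" by (simp add: Suc)
      have "fps_nth ((1 - fps_const (t ^ Suc k) * (fps_const s * fps_X)) * Z (Suc k)) n =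
          s ^ n * (\<Prod>i=1..Suc k. 1 - t ^ (n + i)) -
          t ^ Suc k * s * (s ^ l * (\<Prod>i=1..Suc k. 1 - t ^ (l + i)))"
        by (simp add: Suc left_diff_distrib mult.assoc Z_def del: power_Suc prod.cl_ivl_Suc fps_const_mult)
      also have "\<dots> = (1 - t ^ Suc k) * (s ^ n * P)"
        unfolding 1 2 by (simp add: Suc power_add algebra_simps)
      finally show ?thesis by (simp add: Z_def P_def)
    qed
  qed
  then show ?case
    using Suc unfolding Z_def
    by (simp only: prod.atLeast0_atMost_Suc mult.assoc qpoch_Suc)
      (simp only: mult.left_commute[of _ "fps_const _" "Abs_fps _"] fps_const_mult)
qed

section \<open>Signed Gaussian coefficients and the finite q-binomial theorem\<close>

definition gauss_coeff :: "'a::field \<Rightarrow> nat \<Rightarrow> nat \<Rightarrow> 'a" where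
  "gauss_coeff t n k = (if k \<le> n
     then (- 1) ^ k * (\<Prod>i=1..k. t ^ i) * qpoch t n / (qpoch t (n - k) * qpoch t k) else 0)"

text \<open>The q-Pascal rule with the sign and the power $t^{k(k+1)/2}$ built in; the value 0
  beyond \<open>n\<close> covers the boundary.\<close>

lemma gauss_coeff_Suc:
  fixes t :: "'a::field"
  assumes t: "\<And>n. n > 0 \<Longrightarrow> t ^ n \<noteq> 1"
  shows "gauss_coeff t (Suc n) (Suc k) = gauss_coeff t n (Suc k) - t ^ Suc n * gauss_coeff t n k"
proof -
  have nz: "qpoch t j \<noteq> 0" for j using t by (rule qpoch_ne_0)
  consider "k < n" | "k = n" | "k > n" by linarith
  then show ?thesis
  proof cases
    case 1
    then obtain d where n: "n = Suc (k + d)" using less_iff_Suc_add by auto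
    define X where "X = t ^ Suc k"
    define Y where "Y = t ^ Suc d"
    define R where "R = (- 1) ^ k * (\<Prod>i=1..k. t ^ i) * qpoch t n"
    have XY: "t ^ Suc n = X * Y" by (simp add: n X_def Y_def power_add)
    have nz': "1 - X \<noteq> 0" "1 - Y \<noteq> 0"
      using t[of "Suc k"] t[of "Suc d"] by (auto simp: X_def Y_def)
    have a: "gauss_coeff t (Suc n) (Suc k) =
        - R * X * (1 - X * Y) / ((1 - Y) * qpoch t d * ((1 - X) * qpoch t k))"
      unfolding gauss_coeff_def qpoch_Suc[of t n] XY
      by (simp add: n qpoch_Suc[of t k] qpoch_Suc[of t d] R_def X_def Y_def)
    have b: "gauss_coeff t n (Suc k) = - R * X / (qpoch t d * ((1 - X) * qpoch t k))"
      unfolding gauss_coeff_def by (simp add: n qpoch_Suc[of t k] R_def X_def)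
    have c: "gauss_coeff t n k = R / ((1 - Y) * qpoch t d * qpoch t k)"
      unfolding gauss_coeff_def by (simp add: n qpoch_Suc[of t d] R_def Y_def)
    show ?thesis
      unfolding a b c XY using nz nz' by (simp add: divide_simps) (simp add: algebra_simps)
  next
    case 2
    then show ?thesis using nz by (simp add: gauss_coeff_def)
  qed (simp add: gauss_coeff_def)
qed

text \<open>Multiplication by $1 - t^{n+1} Y$ acts on the coefficients by the q-Pascal rule.\<close>

lemma gauss_binomial:
  fixes t :: "'a::field"
  assumes t: "\<And>n. n > 0 \<Longrightarrow> t ^ n \<noteq> 1"
  shows "(\<Prod>i=1..n. 1 - fps_const (t ^ i) * Y) = (\<Sum>k\<le>n. fps_const (gauss_coeff t n k) * Y ^ k)"
proof (induction n)
  case (Suc n)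
  have z: "gauss_coeff t m 0 = 1" for m
    using qpoch_ne_0[OF t] by (simp add: gauss_coeff_def)
  have step: "fps_const (gauss_coeff t (Suc n) (Suc k)) =
      fps_const (gauss_coeff t n (Suc k)) - fps_const (t ^ Suc n) * fps_const (gauss_coeff t n k)" for k
    by (subst gauss_coeff_Suc) (simp_all add: t)
  have "(\<Sum>k\<le>Suc n. fps_const (gauss_coeff t (Suc n) k) * Y ^ k) =
      1 + (\<Sum>k\<le>n. fps_const (gauss_coeff t n (Suc k)) * Y ^ Suc k) -
      fps_const (t ^ Suc n) * Y * (\<Sum>k\<le>n. fps_const (gauss_coeff t n k) * Y ^ k)"
    unfolding sum.atMost_Suc_shift step sum_distrib_left
    by (simp add: z algebra_simps sum_subtractf del: fps_const_mult)
  also have "1 + (\<Sum>k\<le>n. fps_const (gauss_coeff t n (Suc k)) * Y ^ Suc k) =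
      (\<Sum>k\<le>Suc n. fps_const (gauss_coeff t n k) * Y ^ k)"
    unfolding sum.atMost_Suc_shift by (simp add: z)
  also have "\<dots> = (\<Sum>k\<le>n. fps_const (gauss_coeff t n k) * Y ^ k)"
    by (simp add: gauss_coeff_def)
  finally have F: "(\<Sum>k\<le>Suc n. fps_const (gauss_coeff t (Suc n) k) * Y ^ k) =
      (\<Sum>k\<le>n. fps_const (gauss_coeff t n k) * Y ^ k) -
      fps_const (t ^ Suc n) * Y * (\<Sum>k\<le>n. fps_const (gauss_coeff t n k) * Y ^ k)" .
  show ?case
    unfolding F Suc[symmetric] by (simp add: algebra_simps)
qed (simp add: gauss_coeff_def)

section \<open>The constant $[2m-1]!!$\<close>

lemma qnum_odd: "qnum (2 * int (Suc m) - 1) = (1 - (q\<^sup>2) ^ Suc (2 * m)) / ((q\<^sup>2) ^ m * (1 - q\<^sup>2))"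
proof -
  have e: "2 * int (Suc m) - 1 = int (Suc (2 * m))" by simp
  have d: "1 - q\<^sup>2 \<noteq> 0" using q_power_ne_1[of 2] by auto
  have p: "q ^ Suc (2 * m) = q * (q\<^sup>2) ^ m" by (simp add: power_mult)
  show ?thesis
    unfolding qnum_def e q_minus_power_diff q_inverse_minus p using d by (simp add: field_simps)
qed

text \<open>In $(t;t)_{2m}$ with $t = q^2$ the even exponents form $(t^2;t^2)_m$ and the odd ones
  give $[2m-1]!!$ up to powers of $t$ and $1-t$. The other factors are those met in the final
  constant.\<close>

lemma qdfact_odd_identity:
  "(q\<^sup>2) ^ m * (q * (1 - q\<^sup>2)) ^ m * qpoch (q\<^sup>2) (2 * m) =
     (1 - q\<^sup>2) ^ (2 * m) * qpoch (q ^ 4) m * (\<Prod>n=1..m. (q\<^sup>2) ^ n) * qdfact_odd m * q ^ m"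
proof (induction m)
  case (Suc m)
  define t where "t = q\<^sup>2"
  have q4: "q ^ 4 = t\<^sup>2" by (simp add: t_def)
  have d: "1 - t \<noteq> 0" "t \<noteq> 0" using q_power_ne_1[of 2] by (auto simp: t_def)
  have f: "qdfact_odd (Suc m) = qdfact_odd m * ((1 - t ^ Suc (2 * m)) / (t ^ m * (1 - t)))"
    unfolding t_def qnum_odd[symmetric] by (simp add: qdfact_odd_def del: of_nat_Suc)
  have "t ^ Suc m * (q * (1 - t)) ^ Suc m * qpoch t (2 * Suc m) =
     (t ^ m * (q * (1 - t)) ^ m * qpoch t (2 * m)) * (t * q * (1 - t)) * (1 - t ^ Suc (2 * m)) * (1 - (t\<^sup>2) ^ Suc m)"
    by (simp add: qpoch_Suc power_mult power2_eq_square mult_ac power_mult_distrib)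
  also have "\<dots> = ((1 - t) ^ (2 * m) * qpoch (t\<^sup>2) m * (\<Prod>n=1..m. t ^ n) * qdfact_odd m * q ^ m) *
      (t * q * (1 - t)) * (1 - t ^ Suc (2 * m)) * (1 - (t\<^sup>2) ^ Suc m)"
    using Suc unfolding q4 t_def[symmetric] by simp
  also have "\<dots> = (1 - t) ^ (2 * Suc m) * qpoch (t\<^sup>2) (Suc m) * (\<Prod>n=1..Suc m. t ^ n) * qdfact_odd (Suc m) * q ^ Suc m"
    using d unfolding f qpoch_Suc by (simp add: divide_simps)
  finally show ?case unfolding q4 t_def[symmetric] .
qed (simp add: qdfact_odd_def)

section \<open>The average of a power sum, and content products of hooks\<close>

lemma average_psum:
  assumes "is_q_gaussian_average N L" and "n > 0"
  shows "L (psum n) = (\<Sum>b<n. (- 1) ^ b *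
    (specialize (delta_spec 2) (hook hsym (n - 1 - b) b) *
     (princ_hook (q\<^sup>2) (q / q ^ N) (q * q ^ N) (n - 1 - b) b / princ_hook (q\<^sup>2) (1 - q\<^sup>2) 0 (n - 1 - b) b)))"
proof -
  interpret L: Vector_Spaces.linear sym_scale "(*)" L
    using assms(1) by (simp add: is_q_gaussian_average_def)
  \<comment> \<open>Signs become scalars so that linearity over \<open>sym_scale\<close>
    applies.\<close>
  have sc: "(- 1) ^ b * f = sym_scale ((- 1) ^ b) f" for b f
    by (cases "even b") (simp_all add: sym_scale_def single_uminus)
  have "L (hook hsym a b) =
      specialize (delta_spec 2) (schur (Suc a # replicate b 1)) / specialize (delta_spec 1) (schur (Suc a # replicate b 1))
          * specialize (pstar N) (schur (Suc a # replicate b 1))" for a b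
    using assms(1) is_partition_hook[of a b] unfolding is_q_gaussian_average_def schur_hook[symmetric] by blast
  then show ?thesis
    unfolding psum_hook[OF assms(2)] sc
    by (simp add: L.sum L.scale schur_hook specialize_delta_spec_1_hook specialize_pstar_hook del: One_nat_def)
qed

text \<open>The product of $1 - t^{N+c}$ over the contents $c$ of the hook; leg factors are
  fractions because $N - i$ may be negative.\<close>

definition content_prod :: "'a::field \<Rightarrow> nat \<Rightarrow> nat \<Rightarrow> nat \<Rightarrow> 'a" where
  "content_prod t N a b = (\<Prod>i\<le>a. 1 - t ^ (N + i)) * (\<Prod>i=1..b. (t ^ i - t ^ N) / t ^ i)"

text \<open>The hook lengths cancel. The denominator, with $v = 0$, leaves $(1-t)^{a+b+1}$ and the
  powers $t^i$ that normalize the leg factors.\<close>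

lemma princ_hook_ratio:
  fixes t u :: "'a::field"
  assumes t: "\<And>n. n > 0 \<Longrightarrow> t ^ n \<noteq> 1" "t \<noteq> 0"
  shows "princ_hook t u (u * t ^ N) a b / princ_hook t (1 - t) 0 a b =
     (u / (1 - t)) ^ Suc (a + b) * content_prod t N a b"
proof -
  define P where "P = (\<Prod>i\<le>a. 1 - t ^ (N + i))"
  define Q where "Q = (\<Prod>i=1..b. t ^ i - t ^ N)"
  define T where "T = (\<Prod>i=1..b. t ^ i)"
  define D where "D = (1 - t ^ Suc (a + b)) * qpoch t a * qpoch t b"
  have nz: "D \<noteq> 0" "T \<noteq> 0" "1 - t \<noteq> 0"
    using qpoch_ne_0[of t] one_minus_power_ne_0[of t] t(1)[of 1] t(1)[of "Suc (a + b)"] t unfolding D_def T_def by auto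
  have 1: "(\<Prod>i\<le>a. u - u * t ^ N * t ^ i) = u ^ Suc a * P"
    unfolding P_def using prod.distrib[of "\<lambda>_. u" "\<lambda>i. 1 - t ^ (N + i)" "{..a}"]
    by (simp add: power_add algebra_simps)
  have 2: "(\<Prod>i=1..b. u * t ^ i - u * t ^ N) = u ^ b * Q"
    unfolding Q_def using prod.distrib[of "\<lambda>_. u" "\<lambda>i. t ^ i - t ^ N" "{1..b}"]
    by (simp add: algebra_simps)
  have 3: "(\<Prod>i=1..b. (1 - t) * t ^ i - 0) = (1 - t) ^ b * T"
    unfolding T_def by (simp add: prod.distrib)
  have 4: "content_prod t N a b = P * (Q / T)"
    by (simp add: content_prod_def P_def Q_def T_def prod_dividef)
  show ?thesis
    unfolding princ_hook_def 1 2 3 4 D_def[symmetric]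
    using nz by (simp add: power_add power_divide field_simps)
qed

text \<open>The hook contains a cell of content $-N$, whose factor is zero; for $N = 0$ it is the
  corner, counted with the arm.\<close>

lemma content_prod_eq_0:
  assumes "N \<le> b"
  shows "content_prod t N a b = 0"
proof (cases "N = 0")
  case True
  then have "(\<Prod>i\<le>a. 1 - t ^ (N + i)) = 0"
    by (intro prod_zero) (auto intro!: bexI[of _ 0])
  then show ?thesis by (simp add: content_prod_def)
next
  case False
  with assms have "(\<Prod>i=1..b. (t ^ i - t ^ N) / t ^ i) = 0"
    by (intro prod_zero) (auto intro!: bexI[of _ N])
  then show ?thesis by (simp add: content_prod_def)
qed

text \<open>For $N = n+b+1$ the exponents $N + c$ run through $n+1, ..., n+a+b+1$.\<close>

lemma content_prod_shift:
  fixes t :: "'a::field"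
  assumes "t \<noteq> 0"
  shows "content_prod t (n + Suc b) a b = (\<Prod>i=1..Suc (a + b). 1 - t ^ (n + i))"
proof -
  have "(\<Prod>i=1..b. (t ^ i - t ^ (n + Suc b)) / t ^ i) = (\<Prod>i=1..b. 1 - t ^ (n + (Suc b - i)))"
  proof (rule prod.cong[OF refl])
    fix i assume "i \<in> {1..b}"
    then have "n + Suc b = i + (n + (Suc b - i))" by auto
    then have "t ^ (n + Suc b) = t ^ i * t ^ (n + (Suc b - i))" by (metis power_add)
    then show "(t ^ i - t ^ (n + Suc b)) / t ^ i = 1 - t ^ (n + (Suc b - i))"
      using assms by (simp add: field_simps)
  qed
  also have "\<dots> = (\<Prod>i=1..b. 1 - t ^ (n + i))"
    by (rule prod.reindex_bij_witness[of _ "\<lambda>i. Suc b - i" "\<lambda>i. Suc b - i"]) auto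
  moreover have "(\<Prod>i\<le>a. 1 - t ^ (n + Suc b + i)) = (\<Prod>i=b+1..b+Suc a. 1 - t ^ (n + i))"
    by (rule prod.reindex_bij_witness[of _ "\<lambda>i. i - Suc b" "\<lambda>i. i + Suc b"]) (auto simp: add_ac)
  ultimately show ?thesis
    using prod.ub_add_nat[of 1 b "\<lambda>i. 1 - t ^ (n + i)" "Suc a"]
    by (simp add: content_prod_def add_ac mult.commute del: prod.cl_ivl_Suc)
qed

text \<open>The first $b+1$ coefficients vanish, so the series is that of
  \<open>gf_shifted_product\<close> shifted by $b+1$ places.\<close>

lemma gf_content_prod:
  fixes s t :: "'a::field"
  assumes "t \<noteq> 0"
  shows "(\<Prod>j=0..Suc (a + b). 1 - fps_const (t ^ j) * (fps_const s * fps_X)) *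
      Abs_fps (\<lambda>N. s ^ N * content_prod t N a b) =
    fps_const (qpoch t (Suc (a + b))) * (fps_const s * fps_X) ^ Suc b"
proof -
  have E: "Abs_fps (\<lambda>N. s ^ N * content_prod t N a b) =
      Abs_fps (\<lambda>n. s ^ n * (\<Prod>i=1..Suc (a + b). 1 - t ^ (n + i))) * (fps_const s * fps_X) ^ Suc b"
  proof (rule fps_ext)
    fix N
    have "fps_nth (Abs_fps (\<lambda>n. s ^ n * (\<Prod>i=1..Suc (a + b). 1 - t ^ (n + i))) * (fps_const s * fps_X) ^ Suc b) N =
      (if N < Suc b then 0 else s ^ Suc b * (s ^ (N - Suc b) * (\<Prod>i=1..Suc (a + b). 1 - t ^ (N - Suc b + i))))"
      unfolding power_mult_distrib fps_const_power
      by (subst mult.left_commute) (simp add: fps_X_power_mult_right_nth del: power_Suc prod.cl_ivl_Suc)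
    also have "\<dots> = s ^ N * content_prod t N a b"
    proof (cases "N < Suc b")
      case False
      then obtain n where N: "N = n + Suc b" using le_Suc_ex[of "Suc b" N] by (auto simp: add.commute)
      show ?thesis unfolding N content_prod_shift[OF assms] by (simp add: power_add del: prod.cl_ivl_Suc)
    qed (simp add: content_prod_eq_0)
    finally show "fps_nth (Abs_fps (\<lambda>N. s ^ N * content_prod t N a b)) N = fps_nth (Abs_fps (\<lambda>n. s ^ n *
        (\<Prod>i=1..Suc (a + b). 1 - t ^ (n + i))) * (fps_const s * fps_X) ^ Suc b) N" by simp
  qed
  show ?thesis
    unfolding E by (subst mult.assoc[symmetric]) (simp only: gf_shifted_product)
qed

lemma sum_pairs: "(\<Sum>b<2 * m. f b) = (\<Sum>k<m. f (2 * k) + f (Suc (2 * k)))"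
  for f :: "nat \<Rightarrow> 'a::comm_monoid_add"
  by (induction m) (simp_all add: add.assoc)

text \<open>Legs $2k$ and $2k+1$ reduce to the same half-size hook with the same total sign, hence
  the factor $1 + Y$; the rest is a q-binomial sum in $Y^2$.\<close>

lemma delta_spec_2_hook_gf:
  fixes Y :: "qfield fps"
  defines "t \<equiv> q ^ 4" and "c \<equiv> q * (1 - q\<^sup>2)"
  assumes "m > 0"
  shows "(\<Sum>b<2 * m. fps_const ((- 1) ^ b * specialize (delta_spec 2) (hook hsym (2 * m - 1 - b) b)) * Y ^ b) =
    fps_const (c ^ m / qpoch t m) * (1 + Y) * (\<Prod>i=1..m-1. 1 - fps_const (t ^ i) * Y\<^sup>2)"
proof -
  obtain n where m: "m = Suc n" using assms by (cases m) auto
  have t: "\<And>n. n > 0 \<Longrightarrow> t ^ n \<noteq> 1" unfolding t_def by (rule q4_power_ne_1)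
  have nz: "qpoch t n \<noteq> 0" for n using t by (rule qpoch_ne_0)
  define S where "S k = (- 1) ^ k * princ_hook t c 0 (n - k) k" for k
  have e: "S k = c ^ m / qpoch t m * gauss_coeff t n k" if "k \<le> n" for k
  proof -
    have p: "(\<Prod>i=1..k. c * t ^ i - 0) = c ^ k * (\<Prod>i=1..k. t ^ i)"
      by (simp add: prod.distrib)
    have c: "c ^ Suc (n - k) * c ^ k = c ^ Suc n"
      using that by (simp flip: power_add)
    have "princ_hook t c 0 (n - k) k =
        (c ^ Suc (n - k) * c ^ k) * (\<Prod>i=1..k. t ^ i) / ((1 - t ^ Suc n) * qpoch t (n - k) * qpoch t k)"
      unfolding princ_hook_def p using that by simp
    then show ?thesis
      unfolding c using that nz[of n] by (simp add: S_def m gauss_coeff_def qpoch_Suc mult_ac)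
  qed
  have "(\<Sum>b<2 * m. fps_const ((- 1) ^ b * specialize (delta_spec 2) (hook hsym (2 * m - 1 - b) b)) * Y ^ b) =
      (\<Sum>k\<le>n. fps_const (S k) * Y ^ (2 * k) + fps_const (S k) * Y ^ Suc (2 * k))"
    unfolding sum_pairs m lessThan_Suc_atMost
  proof (rule sum.cong[OF refl])
    fix k assume "k \<in> {..n}"
    then have *: "2 * Suc n - 1 - 2 * k = Suc (2 * (n - k))" "2 * Suc n - 1 - Suc (2 * k) = 2 * (n - k)"
      by auto
    show "fps_const ((- 1) ^ (2 * k) * specialize (delta_spec 2) (hook hsym (2 * Suc n - 1 - 2 * k) (2 * k))) * Y ^ (2 * k) +
      fps_const ((- 1) ^ Suc (2 * k) * specialize (delta_spec 2) (hook hsym (2 * Suc n - 1 - Suc (2 * k)) (Suc (2 * k)))) * Y ^ Suc (2 * k) =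
      fps_const (S k) * Y ^ (2 * k) + fps_const (S k) * Y ^ Suc (2 * k)"
      unfolding * specialize_delta_spec_2_hook by (simp add: S_def t_def c_def)
  qed
  also have "\<dots> = (1 + Y) * (\<Sum>k\<le>n. fps_const (S k) * (Y\<^sup>2) ^ k)"
    unfolding sum_distrib_left by (rule sum.cong, simp, simp only: power_mult power_Suc, simp add: algebra_simps)
  also have "(\<Sum>k\<le>n. fps_const (S k) * (Y\<^sup>2) ^ k) =
      fps_const (c ^ m / qpoch t m) * (\<Sum>k\<le>n. fps_const (gauss_coeff t n k) * (Y\<^sup>2) ^ k)"
    unfolding sum_distrib_left by (rule sum.cong) (simp_all add: e flip: mult.assoc)
  also have "(\<Sum>k\<le>n. fps_const (gauss_coeff t n k) * (Y\<^sup>2) ^ k) = (\<Prod>i=1..n. 1 - fps_const (t ^ i) * Y\<^sup>2)"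
    by (rule gauss_binomial[symmetric]) (rule t)
  finally show ?thesis by (simp add: m mult_ac)
qed

theorem mainTheorem1:
  fixes avg :: "nat \<Rightarrow> symfun \<Rightarrow> qfield" and m :: nat
  assumes "\<And>N. is_q_gaussian_average N (avg N)"
    and "m \<ge> 1"
  shows "Abs_fps (\<lambda>N. avg N (psum (2 * m))) =
    fps_const (qdfact_odd m) *
    ((fps_const (q ^ m) * fps_X * (\<Prod>n=1..m. fps_const (q ^ (2 * n)) + fps_X)) /
     ((fps_const (q ^ (2 * m)) - fps_X) *
      (\<Prod>n=0..m. 1 - fps_const (q ^ (2 * n)) * fps_X)))"
proof -
  define t where "t = q\<^sup>2"
  define c where "c = q * (1 - t)"
  \<comment> \<open>The size enters through $(q^{-N})^{2m} = s^N$, so $M = sX$ is the natural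
    variable; \<open>K0\<close> below is the part of the prefactor independent of $N$.\<close>
  define s where "s = 1 / t ^ m"
  define M where "M = fps_const s * fps_X"
  define F where "F = Abs_fps (\<lambda>N. avg N (psum (2 * m)))"
  define B where "B b = (- 1) ^ b * specialize (delta_spec 2) (hook hsym (2 * m - 1 - b) b)" for b
  define K0 where "K0 = t ^ m / (1 - t) ^ (2 * m)"
  define T where "T = (\<Prod>n=1..m. t ^ n)"
  define R where "R i j = (\<Prod>k=i..j. 1 - fps_const (t ^ k) * M)" for i j
  have t: "\<And>n. n > 0 \<Longrightarrow> t ^ n \<noteq> 1" unfolding t_def by (rule q2_power_ne_1)
  have t0 [simp]: "t \<noteq> 0" by (simp add: t_def)
  have t1: "1 - t \<noteq> 0" using t[of 1] by simp
  have q4: "q ^ 4 = t\<^sup>2" by (simp add: t_def)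
  have st: "t ^ m * s = 1" by (simp add: s_def)
  have qp: "qpoch (t\<^sup>2) m \<noteq> 0" unfolding q4[symmetric] by (rule qpoch_ne_0) (rule q4_power_ne_1)
  have T0: "T \<noteq> 0" by (simp add: T_def)

  have avg: "avg N (psum (2 * m)) = (\<Sum>b<2 * m. B b * (K0 * (s ^ N * content_prod t N (2 * m - 1 - b) b)))" for N
  proof (subst average_psum[OF assms(1)])
    show "2 * m > 0" using assms(2) by simp
    show "(\<Sum>b<2 * m. (- 1) ^ b * (specialize (delta_spec 2) (hook hsym (2 * m - 1 - b) b) *
        (princ_hook (q\<^sup>2) (q / q ^ N) (q * q ^ N) (2 * m - 1 - b) b /
         princ_hook (q\<^sup>2) (1 - q\<^sup>2) 0 (2 * m - 1 - b) b))) =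
      (\<Sum>b<2 * m. B b * (K0 * (s ^ N * content_prod t N (2 * m - 1 - b) b)))"
    proof (rule sum.cong[OF refl])
      fix b assume "b \<in> {..<2 * m}"
      then have ab: "Suc (2 * m - 1 - b + b) = 2 * m" by auto
      have tN: "t ^ N = q ^ N * q ^ N" by (simp add: t_def mult_2 flip: power_mult power_add)
      have v: "q * q ^ N = q / q ^ N * t ^ N" by (simp add: tN)
      have "(q / q ^ N / (1 - t)) ^ (2 * m) = K0 * s ^ N"
      proof -
        have "(q / q ^ N)\<^sup>2 = t / t ^ N"
          unfolding tN by (simp add: t_def power_divide power2_eq_square)
        then have "(q / q ^ N) ^ (2 * m) = (t / t ^ N) ^ m" by (simp add: power_mult)
        also have "\<dots> = t ^ m * s ^ N"
          by (simp add: s_def power_divide mult.commute flip: power_mult)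
        finally show ?thesis unfolding power_divide[of "q / q ^ N" "1 - t"] K0_def by simp
      qed
      then have "princ_hook t (q / q ^ N) (q * q ^ N) (2 * m - 1 - b) b / princ_hook t (1 - t) 0 (2 * m - 1 - b) b =
          K0 * s ^ N * content_prod t N (2 * m - 1 - b) b"
        unfolding v using princ_hook_ratio[where t = t and u = "q / q ^ N" and N = N and a = "2 * m - 1 - b" and b = b] t ab
          by simp
      then show "(- 1) ^ b * (specialize (delta_spec 2) (hook hsym (2 * m - 1 - b) b) *
          (princ_hook (q\<^sup>2) (q / q ^ N) (q * q ^ N) (2 * m - 1 - b) b /
           princ_hook (q\<^sup>2) (1 - q\<^sup>2) 0 (2 * m - 1 - b) b)) =
          B b * (K0 * (s ^ N * content_prod t N (2 * m - 1 - b) b))"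
        unfolding t_def[symmetric] B_def by (simp add: mult.assoc)
    qed
  qed

  have "F = (\<Sum>b<2 * m. fps_const (B b * K0) * Abs_fps (\<lambda>N. s ^ N * content_prod t N (2 * m - 1 - b) b))"
    unfolding F_def avg by (rule fps_ext) (simp add: fps_sum_nth mult.assoc)
  \<comment> \<open>All hooks have size $2m$, so \<open>R 0 (2 * m)\<close> clears the denominators
    for every leg at once.\<close>
  then have "R 0 (2 * m) * F = (\<Sum>b<2 * m. fps_const (B b * K0) *
      (R 0 (2 * m) * Abs_fps (\<lambda>N. s ^ N * content_prod t N (2 * m - 1 - b) b)))"
    by (simp add: sum_distrib_left mult_ac)
  also have "\<dots> = (\<Sum>b<2 * m. fps_const (K0 * qpoch t (2 * m)) * M * (fps_const (B b) * M ^ b))"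
  proof (rule sum.cong[OF refl])
    fix b assume "b \<in> {..<2 * m}"
    then have ab: "Suc (2 * m - 1 - b + b) = 2 * m" by auto
    have "R 0 (2 * m) * Abs_fps (\<lambda>N. s ^ N * content_prod t N (2 * m - 1 - b) b) =
        fps_const (qpoch t (2 * m)) * M ^ Suc b"
      using gf_content_prod[where t = t and a = "2 * m - 1 - b" and b = b and s = s] unfolding ab R_def M_def by simp
    then show "fps_const (B b * K0) * (R 0 (2 * m) * Abs_fps (\<lambda>N. s ^ N * content_prod t N (2 * m - 1 - b) b)) =
        fps_const (K0 * qpoch t (2 * m)) * M * (fps_const (B b) * M ^ b)"
      by (simp add: mult_ac flip: fps_const_mult)
  qed
  also have "\<dots> = fps_const (K0 * qpoch t (2 * m)) * M *
      (fps_const (c ^ m / qpoch (t\<^sup>2) m) * (1 + M) * (\<Prod>i=1..m-1. 1 - fps_const ((t\<^sup>2) ^ i) * M\<^sup>2))"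
    unfolding sum_distrib_left[symmetric] B_def q4[symmetric] c_def t_def
    using delta_spec_2_hook_gf[of m M] assms(2) by simp
  \<comment> \<open>A difference of squares; the minus factors will cancel against part of
    \<open>R 0 (2 * m)\<close>.\<close>
  also have "(\<Prod>i=1..m-1. 1 - fps_const ((t\<^sup>2) ^ i) * M\<^sup>2) =
      R 1 (m - 1) * (\<Prod>i=1..m-1. 1 + fps_const (t ^ i) * M)"
  proof -
    have "1 - fps_const ((t\<^sup>2) ^ i) * M\<^sup>2 = (1 - fps_const (t ^ i) * M) * (1 + fps_const (t ^ i) * M)" for i
      by (simp add: algebra_simps power2_eq_square power_mult_distrib flip: fps_const_mult)
    then show ?thesis by (simp add: R_def prod.distrib)
  qed
  finally have RF: "R 0 (2 * m) * F = fps_const (K0 * qpoch t (2 * m)) * M *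
      (fps_const (c ^ m / qpoch (t\<^sup>2) m) * (1 + M) *
       (R 1 (m - 1) * (\<Prod>i=1..m-1. 1 + fps_const (t ^ i) * M)))" .

  \<comment> \<open>Index 0 will give $q^{2m} - X$ and the indices $m..2m$ the product in the
    claimed denominator.\<close>
  have R_split: "R 0 (2 * m) = (1 - M) * R 1 (m - 1) * R m (2 * m)"
  proof -
    have "R 0 (2 * m) = (1 - M) * R 1 (2 * m)"
      unfolding R_def by (subst prod.atLeast_Suc_atMost) simp_all
    also have "R 1 (2 * m) = R 1 (m - 1) * R m (2 * m)"
      using prod.ub_add_nat[of 1 "m - 1" "\<lambda>k. 1 - fps_const (t ^ k) * M" "Suc m"] assms(2)
      by (simp add: R_def mult_2)
    finally show ?thesis by (simp add: mult.assoc)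
  qed
  have "R 1 (m - 1) \<noteq> 0"
  proof
    assume "R 1 (m - 1) = 0"
    then obtain i where "1 - fps_const (t ^ i) * M = 0" by (auto simp: R_def)
    then have "fps_nth (1 - fps_const (t ^ i) * M) 0 = 0" by simp
    then show False by (simp add: M_def)
  qed
  moreover have "R 1 (m - 1) * ((1 - M) * R m (2 * m) * F) =
      R 1 (m - 1) * (fps_const (K0 * qpoch t (2 * m) * (c ^ m / qpoch (t\<^sup>2) m)) * M *
        ((1 + M) * (\<Prod>i=1..m-1. 1 + fps_const (t ^ i) * M)))"
    using RF unfolding R_split by (simp only: fps_const_mult[symmetric] mult_ac)
  ultimately have main: "(1 - M) * R m (2 * m) * F =
      fps_const (K0 * qpoch t (2 * m) * (c ^ m / qpoch (t\<^sup>2) m)) * M *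
        ((1 + M) * (\<Prod>i=1..m-1. 1 + fps_const (t ^ i) * M))"
    by simp

  have const: "K0 * qpoch t (2 * m) * (c ^ m / qpoch (t\<^sup>2) m) = T * qdfact_odd m * q ^ m"
    using qdfact_odd_identity[of m, folded t_def] qp t1
    unfolding q4 K0_def T_def c_def by (simp add: field_simps)

  have tM: "fps_const (t ^ m) * M = fps_X"
    unfolding M_def mult.assoc[symmetric] fps_const_mult st by simp
  have D1: "fps_const (t ^ m) * (1 - M) = fps_const (q ^ (2 * m)) - fps_X"
    by (simp add: right_diff_distrib tM) (simp add: t_def power_mult)
  have D2: "R m (2 * m) = (\<Prod>n=0..m. 1 - fps_const (q ^ (2 * n)) * fps_X)"
  proof -
    have e: "fps_const (t ^ (m + n)) * M = fps_const (q ^ (2 * n)) * fps_X" for n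
      unfolding power_add fps_const_mult[symmetric] mult.assoc[of _ "fps_const (t ^ n)"]
        mult.left_commute[of _ "fps_const (t ^ n)"] tM by (simp add: t_def power_mult)
    have "R m (2 * m) = (\<Prod>n=0..m. 1 - fps_const (t ^ (m + n)) * M)"
      unfolding R_def by (rule prod.reindex_bij_witness[of _ "\<lambda>n. m + n" "\<lambda>k. k - m"]) auto
    then show ?thesis unfolding e .
  qed
  \<comment> \<open>Each $t^n$ in \<open>T\<close> goes to the factor with index $i = m-n$, turning
    it into $t^n + X$; the factor $1 + M$ belongs to $n = m$.\<close>
  have Num: "fps_const T * ((1 + M) * (\<Prod>i=1..m-1. 1 + fps_const (t ^ i) * M)) =
      (\<Prod>n=1..m. fps_const (q ^ (2 * n)) + fps_X)"
  proof -
    have e: "fps_const (q ^ (2 * n)) + fps_X = fps_const (t ^ n) * (1 + fps_const (t ^ (m - n)) * M)" if "n \<le> m" for n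
    proof -
      have "fps_const (t ^ n) * (fps_const (t ^ (m - n)) * M) = fps_X"
        unfolding mult.assoc[symmetric] fps_const_mult power_add[symmetric] using that tM by simp
      then show ?thesis by (simp add: distrib_left t_def power_mult)
    qed
    have "(\<Prod>n=1..m. fps_const (q ^ (2 * n)) + fps_X) =
        (\<Prod>n=1..m. fps_const (t ^ n) * (1 + fps_const (t ^ (m - n)) * M))"
      by (rule prod.cong) (simp_all add: e)
    also have "\<dots> = (\<Prod>n=1..m. fps_const (t ^ n)) * (\<Prod>n=1..m. 1 + fps_const (t ^ (m - n)) * M)"
      by (rule prod.distrib)
    also have "(\<Prod>n=1..m. fps_const (t ^ n)) = fps_const T"
      unfolding T_def by (induction m) (simp_all flip: fps_const_mult)
    also have "(\<Prod>n=1..m. 1 + fps_const (t ^ (m - n)) * M) = (\<Prod>i=0..m-1. 1 + fps_const (t ^ i) * M)"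
      by (rule prod.reindex_bij_witness[of _ "\<lambda>i. m - i" "\<lambda>i. m - i"]) (use assms(2) in auto)
    also have "\<dots> = (1 + M) * (\<Prod>i=1..m-1. 1 + fps_const (t ^ i) * M)"
      by (subst prod.atLeast_Suc_atMost) simp_all
    finally show ?thesis by simp
  qed

  define Den where "Den = (fps_const (q ^ (2 * m)) - fps_X) * (\<Prod>n=0..m. 1 - fps_const (q ^ (2 * n)) * fps_X)"
  define Nom where "Nom = fps_const (q ^ m) * fps_X * (\<Prod>n=1..m. fps_const (q ^ (2 * n)) + fps_X)"
  have "fps_nth Den 0 \<noteq> 0"
  proof -
    have "fps_nth (\<Prod>n\<in>A. 1 - fps_const (q ^ (2 * n)) * fps_X) 0 = 1" for A :: "nat set"
      by (induction A rule: infinite_finite_induct) simp_all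
    then show ?thesis by (simp add: Den_def)
  qed
  then have Den0: "Den \<noteq> 0" by auto
  have "Den * F = fps_const (t ^ m) * ((1 - M) * R m (2 * m) * F)"
    unfolding Den_def D1[symmetric] D2 by (simp add: mult_ac)
  also have "\<dots> = (fps_const (t ^ m) * M) * (fps_const (qdfact_odd m) * fps_const (q ^ m)) *
      (fps_const T * ((1 + M) * (\<Prod>i=1..m-1. 1 + fps_const (t ^ i) * M)))"
    unfolding main const by (simp add: mult_ac flip: fps_const_mult)
  also have "\<dots> = fps_const (qdfact_odd m) * Nom"
    unfolding Num tM Nom_def by (simp add: mult_ac)
  finally have "F = fps_const (qdfact_odd m) * Nom / Den"
    using Den0 by (metis nonzero_mult_div_cancel_left)
  also have "\<dots> = fps_const (qdfact_odd m) * (Nom / Den)"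
  proof -
    \<comment> \<open>\<open>Den\<close> has nonzero constant term and is a unit; the divisibility
      lets the constant move across the division.\<close>
    have "Den dvd Nom"
      using \<open>fps_nth Den 0 \<noteq> 0\<close> by (metis dvd_trans fps_is_unit_iff one_dvd)
    then show ?thesis by (simp add: div_mult_swap)
  qed
  finally show ?thesis
    unfolding F_def Nom_def Den_def .
qed

end
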